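(* Let $\mathcal{A}$ be a monoid of games that is outcome-stable, hereditary, integer-invertible, and has Property X. Then $\mathcal{P}(\mathcal{A})$, the set of strictly $\mathscr{P}$-free elements of $\mathcal{A}$, is a monoid (in particular it is closed under disjunctive sum).
   Context: Games are short misère-play game forms, possibly augmented in Siegel's sense: any subposition may additionally carry a Left and/or Right tombstone among its options; if a Left (Right) tombstone is present, Left (Right) is deemed to win moving first from there. A game is Left end-like if it has no Left options or has a Left tombstone (Right end-like symmetrically). Outcomes $o(G)\in\{\mathscr{L},\mathscr{N},\mathscr{P},\mathscr{R}\}$; $o_L(G)$, $o_R(G)$ denote the outcome with Left, resp. Right, moving first. $+$ is disjunctive sum, $\overline{G}$ the conjugate, $0=\{\cdot\mid\cdot\}$; for $n\ge1$ the integer $n$ is $\{n-1\mid\cdot\}$ and $\overline{n}$ its conjugate; for $k\in\mathbb{Z}$, $G+k$ means $G+\overline{-k}$ if $k<0$. A subposition of $G$ is any game reachable by a possibly empty, not necessarily alternating, sequence of moves. A game is strictly $\mathscr{P}$-free if no subposition has outcome $\mathscr{P}$; $\mathcal{P}(\mathcal{A})$ is the set of strictly $\mathscr{P}$-free elements of $\mathcal{A}$. $G\geq_{\mathcal{A}}H$ iff $o(G+X)\geq o(H+X)$ for all $X\in\mathcal{A}$; $\equiv_{\mathcal{A}}$ is the associated equivalence. A monoid of games is a nonempty set $\mathcal{A}$ closed under $+$ that contains an identity modulo $\equiv_{\mathcal{A}}$. $\mathcal{A}$ is hereditary if it contains every option of each of its elements. $\mathcal{A}$ is integer-invertible if $n,\overline{n}\in\mathcal{A}$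 and $n+\overline{n}\equiv_{\mathcal{A}}0$ for all integers $n\ge0$. $\mathcal{A}$ is outcome-stable if for all $G,H\in\mathcal{P}(\mathcal{A})$: (1) $o(G)=o(H)=\mathscr{L}$ implies $o(G+H)=\mathscr{L}$; (2) $o(G)=o(H)=\mathscr{R}$ implies $o(G+H)=\mathscr{R}$; (3) $o(G)=\mathscr{L}$, $o(H)=\mathscr{N}$ implies $o_L(G+H)=\mathscr{L}$; (4) $o(G)=\mathscr{R}$, $o(H)=\mathscr{N}$ implies $o_R(G+H)=\mathscr{R}$. Tipping points: $\mathrm{ltp}(G)$ is the least integer $m\ge0$ with $o(G+\overline{m})=\mathscr{L}$, $\mathrm{rtp}(G)$ the least $m\ge0$ with $o(G+m)=\mathscr{R}$. $\mathcal{A}$ has Property X if for all $G,H\in\mathcal{P}(\mathcal{A})$ with $o(G)=o(H)=\mathscr{N}$: (1) if $\mathrm{rtp}(G)=\mathrm{ltp}(H)=1$, $G$ is Left end-like and $H$ is not, then $o(G+H)=\mathscr{N}$; (2) if $\mathrm{ltp}(G)=\mathrm{rtp}(H)=1$, $H$ is Right end-like and $G$ is not, then $o(G+H)=\mathscr{N}$. *)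

theory Defs
  imports Main "HOL-Library.FSet"
begin

text \<open>
  Short augmented game forms. A tombstone is not itself a game, so the two tombstones that may
  occur among the options of a form are recorded by flags.
\<close>

datatype game =
  Game (left_opts: "game fset") (right_opts: "game fset")
       (left_tomb: bool) (right_tomb: bool)

definition left_endlike :: "game \<Rightarrow> bool" where
  "left_endlike G \<longleftrightarrow> left_opts G = {||} \<or> left_tomb G"

definition right_endlike :: "game \<Rightarrow> bool" where
  "right_endlike G \<longleftrightarrow> right_opts G = {||} \<or> right_tomb G"

lemma size_left_opts: "X |\<in>| left_opts G \<Longrightarrow> size X < size G"
proof (cases G)
  case (Game A B l r)
  assume "X |\<in>| left_opts G"
  then have "Suc (size X) \<le> (\<Sum>x\<in>fset A. Suc (size x))"
    using Game by (intro member_le_sum) auto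
  then show ?thesis using Game by simp
qed

lemma size_right_opts: "X |\<in>| right_opts G \<Longrightarrow> size X < size G"
proof (cases G)
  case (Game A B l r)
  assume "X |\<in>| right_opts G"
  then have "Suc (size X) \<le> (\<Sum>x\<in>fset B. Suc (size x))"
    using Game by (intro member_le_sum) auto
  then show ?thesis using Game by simp
qed

instantiation game :: "{zero, plus}"
begin

definition zero_game :: game where
  "0 = Game {||} {||} False False"

text \<open>
  Disjunctive sum of augmented forms, following Siegel: a sum carries a Left tombstone iff both
  summands are Left end-like and at least one of them carries a Left tombstone (and symmetrically
  for Right). On forms without tombstones this is the ordinary disjunctive sum.
\<close>

function plus_game :: "game \<Rightarrow> game \<Rightarrow> game" where
  "plus_game G H =
     Game ((\<lambda>X. plus_game X H) |`| left_opts G |\<union>| (\<lambda>Y. plus_game G Y) |`| left_opts H)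
          ((\<lambda>X. plus_game X H) |`| right_opts G |\<union>| (\<lambda>Y. plus_game G Y) |`| right_opts H)
          (left_endlike G \<and> left_endlike H \<and> (left_tomb G \<or> left_tomb H))
          (right_endlike G \<and> right_endlike H \<and> (right_tomb G \<or> right_tomb H))"
  by auto
termination
  by (relation "measure (\<lambda>(G, H). size G + size H)")
     (auto dest: size_left_opts size_right_opts)

declare plus_game.simps [simp del]

instance ..

end

primrec conjugate :: "game \<Rightarrow> game" where
  "conjugate (Game A B l r) = Game (conjugate |`| B) (conjugate |`| A) r l"

primrec int_game :: "nat \<Rightarrow> game" where
  "int_game 0 = 0"
| "int_game (Suc n) = Game {|int_game n|} {||} False False"

datatype player = Left | Right

text \<open>
  \<open>o_L G\<close> (\<open>o_R G\<close>) is the winner under misere play when Left (Right) moves first.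
\<close>

function o_L :: "game \<Rightarrow> player" and o_R :: "game \<Rightarrow> player" where
  "o_L G = (if left_endlike G \<or> (\<exists>X|\<in>|left_opts G. o_R X = Left) then Left else Right)"
| "o_R G = (if right_endlike G \<or> (\<exists>X|\<in>|right_opts G. o_L X = Right) then Right else Left)"
  by pat_completeness auto
termination
  by (relation "measure (case_sum size size)") (auto dest: size_left_opts size_right_opts)

declare o_L.simps [simp del] o_R.simps [simp del]

datatype outcome = \<L> | \<N> | \<P> | \<R>

instantiation outcome :: order
begin

text \<open>\<open>\<L>\<close> is the top, \<open>\<R>\<close> the bottom; \<open>\<N>\<close> and \<open>\<P>\<close> are incomparable.\<close>

definition less_eq_outcome :: "outcome \<Rightarrow> outcome \<Rightarrow> bool" where
  "a \<le> b \<longleftrightarrow> a = b \<or> a = \<R> \<or> b = \<L>"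

definition less_outcome :: "outcome \<Rightarrow> outcome \<Rightarrow> bool" where
  "(a :: outcome) < b \<longleftrightarrow> a \<le> b \<and> \<not> b \<le> a"

instance
  by standard (auto simp: less_eq_outcome_def less_outcome_def)

end

definition outcome :: "game \<Rightarrow> outcome" where
  "outcome G =
     (case (o_L G, o_R G) of
        (Left, Left) \<Rightarrow> \<L>
      | (Left, Right) \<Rightarrow> \<N>
      | (Right, Left) \<Rightarrow> \<P>
      | (Right, Right) \<Rightarrow> \<R>)"

inductive_set subpositions :: "game \<Rightarrow> game set" for G :: game where
  refl: "G \<in> subpositions G"
| left: "H \<in> subpositions G \<Longrightarrow> X |\<in>| left_opts H \<Longrightarrow> X \<in> subpositions G"
| right: "H \<in> subpositions G \<Longrightarrow> X |\<in>| right_opts H \<Longrightarrow> X \<in> subpositions G"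

definition strictly_P_free :: "game \<Rightarrow> bool" where
  "strictly_P_free G \<longleftrightarrow> (\<forall>H\<in>subpositions G. outcome H \<noteq> \<P>)"

definition P_free_part :: "game set \<Rightarrow> game set" where
  "P_free_part A = {G \<in> A. strictly_P_free G}"

definition game_ge :: "game set \<Rightarrow> game \<Rightarrow> game \<Rightarrow> bool" where
  "game_ge A G H \<longleftrightarrow> (\<forall>X\<in>A. outcome (G + X) \<ge> outcome (H + X))"

definition game_equiv :: "game set \<Rightarrow> game \<Rightarrow> game \<Rightarrow> bool" where
  "game_equiv A G H \<longleftrightarrow> game_ge A G H \<and> game_ge A H G"

definition game_monoid :: "game set \<Rightarrow> bool" where
  "game_monoid A \<longleftrightarrow>
     A \<noteq> {} \<and> (\<forall>G\<in>A. \<forall>H\<in>A. G + H \<in> A) \<and> (\<exists>E\<in>A. \<forall>G\<in>A. game_equiv A (G + E) G)"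

definition hereditary :: "game set \<Rightarrow> bool" where
  "hereditary A \<longleftrightarrow> (\<forall>G\<in>A. \<forall>X. X |\<in>| left_opts G \<or> X |\<in>| right_opts G \<longrightarrow> X \<in> A)"

definition integer_invertible :: "game set \<Rightarrow> bool" where
  "integer_invertible A \<longleftrightarrow>
     (\<forall>n. int_game n \<in> A \<and> conjugate (int_game n) \<in> A \<and>
          game_equiv A (int_game n + conjugate (int_game n)) 0)"

definition outcome_stable :: "game set \<Rightarrow> bool" where
  "outcome_stable A \<longleftrightarrow>
     (\<forall>G\<in>P_free_part A. \<forall>H\<in>P_free_part A.
        (outcome G = \<L> \<and> outcome H = \<L> \<longrightarrow> outcome (G + H) = \<L>) \<and>
        (outcome G = \<R> \<and> outcome H = \<R> \<longrightarrow> outcome (G + H) = \<R>) \<and>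
        (outcome G = \<L> \<and> outcome H = \<N> \<longrightarrow> o_L (G + H) = Left) \<and>
        (outcome G = \<R> \<and> outcome H = \<N> \<longrightarrow> o_R (G + H) = Right))"

text \<open>
  The minima below are over nonempty sets for every \<open>G\<close>: see \<open>ltp_exists\<close> and \<open>rtp_exists\<close>.
\<close>

definition ltp :: "game \<Rightarrow> nat" where
  "ltp G = (LEAST m. outcome (G + conjugate (int_game m)) = \<L>)"

definition rtp :: "game \<Rightarrow> nat" where
  "rtp G = (LEAST m. outcome (G + int_game m) = \<R>)"

definition property_X :: "game set \<Rightarrow> bool" where
  "property_X A \<longleftrightarrow>
     (\<forall>G\<in>P_free_part A. \<forall>H\<in>P_free_part A. outcome G = \<N> \<and> outcome H = \<N> \<longrightarrow>
        (rtp G = 1 \<and> ltp H = 1 \<and> left_endlike G \<and> \<not> left_endlike H \<longrightarrow> outcome (G + H) = \<N>) \<and>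
        (ltp G = 1 \<and> rtp H = 1 \<and> right_endlike H \<and> \<not> right_endlike G \<longrightarrow> outcome (G + H) = \<N>))"

lemma conjugate_int_game_sel [simp]:
  "left_opts (conjugate (int_game m)) = {||}"
  "right_opts (conjugate (int_game m)) =
     (case m of 0 \<Rightarrow> {||} | Suc k \<Rightarrow> {|conjugate (int_game k)|})"
  "\<not> left_tomb (conjugate (int_game m))"
  "\<not> right_tomb (conjugate (int_game m))"
  by (cases m; simp add: zero_game_def)+

lemma int_game_sel [simp]:
  "right_opts (int_game m) = {||}"
  "left_opts (int_game m) = (case m of 0 \<Rightarrow> {||} | Suc k \<Rightarrow> {|int_game k|})"
  "\<not> left_tomb (int_game m)"
  "\<not> right_tomb (int_game m)"
  by (cases m; simp add: zero_game_def)+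

lemma plus_game_sel:
  fixes G H :: game
  shows "left_opts (G + H) = (\<lambda>X. X + H) |`| left_opts G |\<union>| (\<lambda>Y. G + Y) |`| left_opts H"
    and "right_opts (G + H) = (\<lambda>X. X + H) |`| right_opts G |\<union>| (\<lambda>Y. G + Y) |`| right_opts H"
    and "left_tomb (G + H) \<longleftrightarrow>
           left_endlike G \<and> left_endlike H \<and> (left_tomb G \<or> left_tomb H)"
    and "right_tomb (G + H) \<longleftrightarrow>
           right_endlike G \<and> right_endlike H \<and> (right_tomb G \<or> right_tomb H)"
  by (subst plus_game.simps, simp)+

lemma left_wins_far:
  "(size G \<le> m \<longrightarrow> o_L (G + conjugate (int_game m)) = Left) \<and>
   (size G < m \<longrightarrow> o_R (G + conjugate (int_game m)) = Left)"
proof (induction "size G + m" arbitrary: G m rule: less_induct)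
  case less
  let ?M = "conjugate (int_game m)"
  have "o_L (G + ?M) = Left" if m: "size G \<le> m"
  proof (cases "left_endlike G")
    case True
    then have "left_endlike (G + ?M)"
      by (auto simp: left_endlike_def plus_game_sel)
    then show ?thesis by (simp add: o_L.simps)
  next
    case False
    then obtain X where X: "X |\<in>| left_opts G"
      by (auto simp: left_endlike_def)
    then have "size X < size G" by (rule size_left_opts)
    then have "o_R (X + ?M) = Left" using less[of X m] m by simp
    moreover have "X + ?M |\<in>| left_opts (G + ?M)" using X by (simp add: plus_game_sel)
    ultimately show ?thesis by (subst o_L.simps) auto
  qed
  moreover have "o_R (G + ?M) = Left" if m: "size G < m"
  proof -
    from m obtain k where k: "m = Suc k" by (cases m) auto
    have "\<not> right_endlike (G + ?M)"
      by (simp add: right_endlike_def plus_game_sel k)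
    moreover have "o_L Z = Left" if Z: "Z |\<in>| right_opts (G + ?M)" for Z
    proof -
      from Z consider X where "X |\<in>| right_opts G" "Z = X + ?M"
        | "Z = G + conjugate (int_game k)"
        by (auto simp: plus_game_sel k)
      then show ?thesis
      proof cases
        case 1
        then show ?thesis using less[of X m] m size_right_opts[of X G] by simp
      next
        case 2
        then show ?thesis using less[of G k] m k by simp
      qed
    qed
    ultimately show ?thesis by (subst o_R.simps) auto
  qed
  ultimately show ?case by blast
qed

lemma right_wins_far:
  "(size G \<le> m \<longrightarrow> o_R (G + int_game m) = Right) \<and>
   (size G < m \<longrightarrow> o_L (G + int_game m) = Right)"
proof (induction "size G + m" arbitrary: G m rule: less_induct)
  case less
  let ?M = "int_game m"
  have "o_R (G + ?M) = Right" if m: "size G \<le> m"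
  proof (cases "right_endlike G")
    case True
    then have "right_endlike (G + ?M)"
      by (auto simp: right_endlike_def plus_game_sel)
    then show ?thesis by (simp add: o_R.simps)
  next
    case False
    then obtain X where X: "X |\<in>| right_opts G"
      by (auto simp: right_endlike_def)
    then have "size X < size G" by (rule size_right_opts)
    then have "o_L (X + ?M) = Right" using less[of X m] m by simp
    moreover have "X + ?M |\<in>| right_opts (G + ?M)" using X by (simp add: plus_game_sel)
    ultimately show ?thesis by (subst o_R.simps) auto
  qed
  moreover have "o_L (G + ?M) = Right" if m: "size G < m"
  proof -
    from m obtain k where k: "m = Suc k" by (cases m) auto
    have "\<not> left_endlike (G + ?M)"
      by (simp add: left_endlike_def plus_game_sel k del: int_game.simps)
    moreover have "o_R Z = Right" if Z: "Z |\<in>| left_opts (G + ?M)" for Z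
    proof -
      from Z consider X where "X |\<in>| left_opts G" "Z = X + ?M"
        | "Z = G + int_game k"
        by (auto simp: plus_game_sel k)
      then show ?thesis
      proof cases
        case 1
        then show ?thesis using less[of X m] m size_left_opts[of X G] by simp
      next
        case 2
        then show ?thesis using less[of G k] m k by simp
      qed
    qed
    ultimately show ?thesis by (subst o_L.simps) auto
  qed
  ultimately show ?case by blast
qed

lemma ltp_exists: "\<exists>m. outcome (G + conjugate (int_game m)) = \<L>"
  using left_wins_far[of G "Suc (size G)"] by (intro exI[of _ "Suc (size G)"]) (simp add: outcome_def)

lemma rtp_exists: "\<exists>m. outcome (G + int_game m) = \<R>"
  using right_wins_far[of G "Suc (size G)"] by (intro exI[of _ "Suc (size G)"]) (simp add: outcome_def)

end

theory Submission
  imports Defs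
begin

text \<open>
  Subpositions of a sum are sums of subpositions, so it suffices that no sum \<open>G + H\<close> of strictly
  \<open>\<P>\<close>-free elements has outcome \<open>\<P>\<close>. Since \<open>k\<close> and \<open>- k\<close> cancel, an integer carries free moves
  from one summand to the other. The key claim is that, for all integers \<open>i\<close> and \<open>j\<close>, if Left wins
  moving first on \<open>G + i\<close> and moving second on \<open>H + j\<close>, then she wins moving first on
  \<open>G + H + (i + j + 1)\<close>. Quantifying over \<open>i\<close> and \<open>j\<close> makes the induction on the sizes of \<open>G\<close> and
  \<open>H\<close> go through: Left makes a winning move in one summand, and every reply of Right is again
  covered by the claim. Outcome stability and Property X settle the case in which Left wins
  \<open>G + i\<close> without a move.

  Given the claim, choose \<open>i\<close> with Left winning first on \<open>G + i\<close> but not on \<open>G + (i + 1)\<close>. If Left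
  wins moving second on \<open>H + (- i - 1)\<close>, then Left wins moving first on \<open>G + H\<close>; otherwise outcome
  stability applied to \<open>(G + (i + 1)) + (H + (- i - 1))\<close> shows that Right does. In neither case is
  the outcome \<open>\<P>\<close>.
\<close>

section \<open>Disjunctive sums\<close>

definition options :: "game \<Rightarrow> game fset" where
  "options G = left_opts G |\<union>| right_opts G"

lemma size_option: "X |\<in>| options G \<Longrightarrow> size X < size G"
  by (auto simp: options_def intro: size_left_opts size_right_opts)

lemma left_endlike_plus: "left_endlike (G + H) \<longleftrightarrow> left_endlike G \<and> left_endlike H"
  by (auto simp: left_endlike_def plus_game_sel)

lemma right_endlike_plus: "right_endlike (G + H) \<longleftrightarrow> right_endlike G \<and> right_endlike H"
  by (auto simp: right_endlike_def plus_game_sel)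

lemma zero_game_sel [simp]:
  "left_opts (0 :: game) = {||}" "right_opts (0 :: game) = {||}"
  "\<not> left_tomb (0 :: game)" "\<not> right_tomb (0 :: game)"
  by (simp_all add: zero_game_def)

lemma game_add_commute: "(G :: game) + H = H + G"
proof (induction G H rule: plus_game.induct)
  case (1 G H)
  then have "left_opts (G + H) = left_opts (H + G)" "right_opts (G + H) = right_opts (H + G)"
    by (auto simp: plus_game_sel image_iff)
  then show ?case
    by (intro game.expand) (auto simp: plus_game_sel)
qed

lemma game_add_assoc: "(G :: game) + H + K = G + (H + K)"
proof (induction "size G + size H + size K" arbitrary: G H K rule: less_induct)
  case less
  have "X + H + K = X + (H + K)" if "X |\<in>| options G" for X
    using that by (intro less) (simp add: size_option)
  moreover have "G + Y + K = G + (Y + K)" if "Y |\<in>| options H" for Y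
    using that by (intro less) (simp add: size_option)
  moreover have "G + H + Z = G + (H + Z)" if "Z |\<in>| options K" for Z
    using that by (intro less) (simp add: size_option)
  ultimately have "left_opts (G + H + K) = left_opts (G + (H + K))"
    "right_opts (G + H + K) = right_opts (G + (H + K))"
    by (simp_all add: options_def plus_game_sel fimage_funion fset.map_comp comp_def funion_assoc
        cong: fset.map_cong)
  then show ?case
    by (intro game.expand) (auto simp: plus_game_sel left_endlike_plus right_endlike_plus)
qed

lemma game_add_0: "(0 :: game) + G = G"
proof (induction G)
  case (Game A B l r)
  then have "left_opts (0 + Game A B l r) = A" "right_opts (0 + Game A B l r) = B"
    by (simp_all add: plus_game_sel cong: fset.map_cong)
  then show ?case
    by (intro game.expand) (auto simp: plus_game_sel left_endlike_def right_endlike_def)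
qed

instance game :: comm_monoid_add
  by standard (rule game_add_assoc game_add_commute game_add_0)+

lemma conjugate_sel:
  "left_opts (conjugate G) = conjugate |`| right_opts G"
  "right_opts (conjugate G) = conjugate |`| left_opts G"
  "left_tomb (conjugate G) = right_tomb G" "right_tomb (conjugate G) = left_tomb G"
  by (cases G; simp)+

lemma conjugate_0 [simp]: "conjugate 0 = 0"
  by (simp add: zero_game_def)

lemma endlike_conjugate:
  "left_endlike (conjugate G) \<longleftrightarrow> right_endlike G"
  "right_endlike (conjugate G) \<longleftrightarrow> left_endlike G"
  by (simp_all add: left_endlike_def right_endlike_def conjugate_sel)

lemma conjugate_plus: "conjugate (G + H) = conjugate G + conjugate H"
proof (induction G H rule: plus_game.induct)
  case (1 G H)
  then have "left_opts (conjugate (G + H)) = left_opts (conjugate G + conjugate H)"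
    "right_opts (conjugate (G + H)) = right_opts (conjugate G + conjugate H)"
    by (simp_all add: plus_game_sel conjugate_sel fimage_funion fset.map_comp comp_def
        cong: fset.map_cong)
  then show ?case
    by (intro game.expand) (simp add: plus_game_sel conjugate_sel endlike_conjugate)
qed

section \<open>Outcomes\<close>

lemma player_neq_iff [simp]: "p \<noteq> Left \<longleftrightarrow> p = Right" "p \<noteq> Right \<longleftrightarrow> p = Left"
  by (cases p; simp)+

lemma o_L_eq_Left_iff: "o_L G = Left \<longleftrightarrow> left_endlike G \<or> (\<exists>X|\<in>|left_opts G. o_R X = Left)"
  by (simp add: o_L.simps)

lemma o_R_eq_Right_iff: "o_R G = Right \<longleftrightarrow> right_endlike G \<or> (\<exists>X|\<in>|right_opts G. o_L X = Right)"
  by (simp add: o_R.simps)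

lemma o_R_eq_Left_iff:
  "o_R G = Left \<longleftrightarrow> \<not> right_endlike G \<and> (\<forall>X|\<in>|right_opts G. o_L X = Left)"
  by (subst o_R.simps) auto

lemma outcome_eq_iff:
  "outcome G = \<L> \<longleftrightarrow> o_L G = Left \<and> o_R G = Left"
  "outcome G = \<N> \<longleftrightarrow> o_L G = Left \<and> o_R G = Right"
  "outcome G = \<P> \<longleftrightarrow> o_L G = Right \<and> o_R G = Left"
  "outcome G = \<R> \<longleftrightarrow> o_L G = Right \<and> o_R G = Right"
  by (cases "o_L G"; cases "o_R G"; simp add: outcome_def)+

lemma outcome_eq_outcome_iff: "outcome G = outcome H \<longleftrightarrow> o_L G = o_L H \<and> o_R G = o_R H"
  by (cases "o_L H"; cases "o_R H"; simp add: outcome_def split: player.split)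

lemma outcome_neq_P_iff: "outcome G \<noteq> \<P> \<longleftrightarrow> o_L G = Left \<or> o_R G = Right"
  by (auto simp: outcome_eq_iff)

section \<open>Strictly \<open>\<P>\<close>-free games\<close>

lemma subpositions_trans:
  assumes "K \<in> subpositions H" "H \<in> subpositions G"
  shows "K \<in> subpositions G"
  using assms by (induction rule: subpositions.induct) (auto intro: subpositions.intros)

lemma option_in_subpositions: "X |\<in>| options G \<Longrightarrow> X \<in> subpositions G"
  by (auto simp: options_def intro: subpositions.intros)

lemma subpositions_plus:
  assumes "K \<in> subpositions (G + H)"
  obtains X Y where "X \<in> subpositions G" "Y \<in> subpositions H" "K = X + Y"
proof -
  have "\<exists>X\<in>subpositions G. \<exists>Y\<in>subpositions H. K = X + Y"
    using assms
    by (induction rule: subpositions.induct)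
      (fastforce simp: plus_game_sel intro: subpositions.intros)+
  then show thesis using that by blast
qed

lemma hereditary_subposition:
  assumes "hereditary A" "G \<in> A" "X \<in> subpositions G"
  shows "X \<in> A"
  using assms(3)
  by (induction rule: subpositions.induct) (use assms(1,2) in \<open>unfold hereditary_def, blast\<close>)+

lemma hereditary_P_free_part:
  assumes "hereditary A"
  shows "hereditary (P_free_part A)"
  using assms option_in_subpositions subpositions_trans
  unfolding hereditary_def P_free_part_def strictly_P_free_def options_def by blast

lemma P_free_part_outcome: "G \<in> P_free_part A \<Longrightarrow> o_L G = Left \<or> o_R G = Right"
  unfolding outcome_neq_P_iff[symmetric]
  by (auto simp: P_free_part_def strictly_P_free_def intro: subpositions.refl)

lemma P_free_part_plusI:
  assumes "hereditary A" "G \<in> P_free_part A" "H \<in> P_free_part A" "G + H \<in> A"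
    and sum: "\<And>X Y. X \<in> P_free_part A \<Longrightarrow> Y \<in> P_free_part A \<Longrightarrow>
      Y \<in> subpositions H \<Longrightarrow> outcome (X + Y) \<noteq> \<P>"
  shows "G + H \<in> P_free_part A"
proof -
  have "outcome K \<noteq> \<P>" if "K \<in> subpositions (G + H)" for K
    using that
  proof (rule subpositions_plus)
    fix X Y assume "X \<in> subpositions G" "Y \<in> subpositions H" "K = X + Y"
    then show ?thesis
      using assms(1-3) by (metis hereditary_P_free_part hereditary_subposition sum)
  qed
  then show ?thesis
    using assms(4) by (simp add: P_free_part_def strictly_P_free_def)
qed

section \<open>Integers\<close>

lemma int_game_add: "int_game (m + n) = int_game m + int_game n"
proof (induction m arbitrary: n)
  case outer: (Suc m)
  show ?case
  proof (induction n)
    case (Suc n)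
    have "left_opts (int_game (Suc m) + int_game (Suc n)) = {|int_game (Suc (m + n))|}"
      using outer[of "Suc n"] Suc by (simp add: plus_game_sel)
    then show ?case
      by (intro game.expand) (auto simp: plus_game_sel)
  qed simp
qed simp

definition integer :: "int \<Rightarrow> game" where
  "integer k = (if k \<ge> 0 then int_game (nat k) else conjugate (int_game (nat (- k))))"

lemma integer_of_nat: "integer (int n) = int_game n"
  by (simp add: integer_def)

lemma integer_uminus_of_nat: "integer (- int n) = conjugate (int_game n)"
  by (simp add: integer_def)

lemma integer_0 [simp]: "integer 0 = 0"
  by (simp add: integer_def)

lemma integer_sel:
  "left_opts (integer k) = (if k > 0 then {|integer (k - 1)|} else {||})"
  "right_opts (integer k) = (if k < 0 then {|integer (k + 1)|} else {||})"
  "\<not> left_tomb (integer k)" "\<not> right_tomb (integer k)"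
proof -
  have "left_opts (integer (int n)) = (if n > 0 then {|integer (int n - 1)|} else {||})" for n
    unfolding integer_of_nat
    by (cases n) (simp_all add: integer_of_nat del: int_game.simps(2))
  moreover have "right_opts (integer (- int n)) =
      (if n > 0 then {|integer (- int n + 1)|} else {||})" for n
    unfolding integer_uminus_of_nat
    by (cases n) (simp_all add: integer_uminus_of_nat del: int_game.simps(2))
  ultimately show "left_opts (integer k) = (if k > 0 then {|integer (k - 1)|} else {||})"
    "right_opts (integer k) = (if k < 0 then {|integer (k + 1)|} else {||})"
    by (cases k rule: int_cases4; force simp: integer_of_nat integer_uminus_of_nat)+
qed (simp_all add: integer_def)

lemma integer_add_same_sign:
  assumes "0 \<le> k \<and> 0 \<le> l \<or> k \<le> 0 \<and> l \<le> 0"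
  shows "integer (k + l) = integer k + integer l"
  using assms
proof
  assume "0 \<le> k \<and> 0 \<le> l"
  then obtain m n where "k = int m" "l = int n" by (meson nonneg_int_cases)
  then show ?thesis by (simp add: integer_of_nat int_game_add flip: of_nat_add)
next
  assume "k \<le> 0 \<and> l \<le> 0"
  then obtain m n where "k = - int m" "l = - int n" by (meson nonpos_int_cases)
  moreover from this have "k + l = - int (m + n)" by simp
  ultimately show ?thesis
    by (simp only: integer_uminus_of_nat int_game_add conjugate_plus)
qed

lemma left_endlike_integer: "left_endlike (integer k) \<longleftrightarrow> k \<le> 0"
  by (auto simp: left_endlike_def integer_sel)

lemma right_endlike_integer: "right_endlike (integer k) \<longleftrightarrow> k \<ge> 0"
  by (auto simp: right_endlike_def integer_sel)

lemma opts_plus_integer: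
  "left_opts (G + integer k) =
     (\<lambda>X. X + integer k) |`| left_opts G |\<union>| (if k > 0 then {|G + integer (k - 1)|} else {||})"
  "right_opts (G + integer k) =
     (\<lambda>X. X + integer k) |`| right_opts G |\<union>| (if k < 0 then {|G + integer (k + 1)|} else {||})"
  by (simp_all add: plus_game_sel integer_sel)

lemma o_L_plus_integer_eq_Left_iff:
  "o_L (G + integer k) = Left \<longleftrightarrow> left_endlike (G + integer k) \<or>
     (\<exists>X|\<in>|left_opts G. o_R (X + integer k) = Left) \<or> (k > 0 \<and> o_R (G + integer (k - 1)) = Left)"
  by (subst o_L_eq_Left_iff) (auto simp: opts_plus_integer)

lemma o_R_plus_integer_eq_Left_iff:
  "o_R (G + integer k) = Left \<longleftrightarrow> \<not> right_endlike (G + integer k) \<and>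
     (\<forall>X|\<in>|right_opts G. o_L (X + integer k) = Left) \<and>
     (k < 0 \<longrightarrow> o_L (G + integer (k + 1)) = Left)"
  by (subst o_R_eq_Left_iff) (auto simp: opts_plus_integer)

lemma o_L_plus_integer_succ:
  assumes "o_R (G + integer k) = Left"
  shows "o_L (G + integer (k + 1)) = Left"
proof (cases "k < 0")
  case True
  then show ?thesis using assms by (simp add: o_R_plus_integer_eq_Left_iff)
next
  case False
  then show ?thesis using assms by (simp add: o_L_plus_integer_eq_Left_iff[of G "k + 1"])
qed

lemma outcome_integer: "outcome (integer k) = (if k < 0 then \<L> else if k = 0 then \<N> else \<R>)"
proof -
  have Left_first: "o_L (integer k) = Left" if "k \<le> 0" for k
    using that by (simp add: o_L_eq_Left_iff left_endlike_integer)
  have Right_first: "o_R (integer k) = Right" if "k \<ge> 0" for k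
    using that by (simp add: o_R_eq_Right_iff right_endlike_integer)
  have "o_L (integer k) = Right" if "k > 0"
    using Right_first[of "k - 1"] that o_L_eq_Left_iff[of "integer k"]
    by (auto simp: left_endlike_integer integer_sel simp flip: player_neq_iff(1))
  moreover have "o_R (integer k) = Left" if "k < 0"
    using Left_first[of "k + 1"] that
    by (simp add: o_R_eq_Left_iff[of "integer k"] right_endlike_integer integer_sel)
  ultimately show ?thesis
    using Left_first[of k] Right_first[of k] Left_first[of 0] Right_first[of 0]
    by (simp add: outcome_eq_iff)
qed

lemma subpositions_integer:
  assumes "K \<in> subpositions (integer k)"
  obtains l where "K = integer l" "\<bar>l\<bar> \<le> \<bar>k\<bar>"
proof -
  have "\<exists>l. K = integer l \<and> \<bar>l\<bar> \<le> \<bar>k\<bar>"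
    using assms by (induction rule: subpositions.induct) (force simp: integer_sel split: if_splits)+
  then show thesis using that by blast
qed

lemma strictly_P_free_integer: "strictly_P_free (integer k)"
  unfolding strictly_P_free_def
  by (metis subpositions_integer outcome_integer outcome.distinct)

lemma rtp_eq_1: "outcome G = \<N> \<Longrightarrow> outcome (G + integer 1) = \<R> \<Longrightarrow> rtp G = 1"
  unfolding rtp_def
  by (rule Least_equality) (use integer_of_nat[of 1] in \<open>auto intro!: Suc_leI gr0I\<close>)

lemma ltp_eq_1: "outcome G = \<N> \<Longrightarrow> outcome (G + integer (- 1)) = \<L> \<Longrightarrow> ltp G = 1"
  unfolding ltp_def
  by (rule Least_equality) (use integer_uminus_of_nat[of 1] in \<open>auto intro!: Suc_leI gr0I\<close>)

lemma left_tipping_integer: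
  obtains i where "o_L (G + integer i) = Left" "o_L (G + integer (i + 1)) = Right"
proof -
  define shifted where "shifted n = G + integer (int n - int (size G))" for n
  have "o_L (shifted 0) = Left"
    using left_wins_far[of G "size G"] by (simp add: shifted_def integer_uminus_of_nat)
  moreover have "o_L (shifted (Suc (2 * size G))) = Right"
    using right_wins_far[of G "Suc (size G)"] integer_of_nat[of "Suc (size G)"]
    by (simp add: shifted_def algebra_simps)
  ultimately obtain n where "o_L (shifted n) = Left" "o_L (shifted (Suc n)) = Right"
    using ex_least_nat_less[of "\<lambda>n. o_L (shifted n) = Right"] by force
  then show thesis
    using that[of "int n - int (size G)"] by (simp add: shifted_def algebra_simps)
qed

section \<open>Sums of shifted games\<close>

definition left_wins_sum :: "game \<Rightarrow> game \<Rightarrow> bool" where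
  "left_wins_sum G H \<longleftrightarrow>
     (\<forall>i j. o_L (G + integer i) = Left \<longrightarrow> o_R (H + integer j) = Left \<longrightarrow>
        o_L (G + H + integer (i + j + 1)) = Left)"

lemma left_wins_sumD:
  assumes "left_wins_sum G H" "o_L (G + integer i) = Left" "o_R (H + integer j) = Left"
    and "k = i + j + 1"
  shows "o_L (G + H + integer k) = Left"
  using assms by (simp add: left_wins_sum_def)

lemma o_R_plus_plus_integer_eq_Left:
  assumes G: "o_R (G + integer i) = Left" and H: "o_R (H + integer j) = Left"
    and G_opts: "\<And>X. X |\<in>| right_opts G \<Longrightarrow> left_wins_sum X H"
    and H_opts: "\<And>Y. Y |\<in>| right_opts H \<Longrightarrow> left_wins_sum Y G"
    and negative: "i + j + 1 < 0 \<Longrightarrow> left_wins_sum G H"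
  shows "o_R (G + H + integer (i + j + 1)) = Left"
proof -
  have "\<not> right_endlike (G + H + integer (i + j + 1))"
    using G H by (auto simp: o_R_eq_Left_iff right_endlike_plus right_endlike_integer)
  moreover have "o_L (X + H + integer (i + j + 1)) = Left" if "X |\<in>| right_opts G" for X
    using G H that by (intro left_wins_sumD[OF G_opts]) (auto simp: o_R_plus_integer_eq_Left_iff)
  moreover have "o_L (G + Y + integer (i + j + 1)) = Left" if "Y |\<in>| right_opts H" for Y
  proof -
    have "o_L (Y + G + integer (i + j + 1)) = Left"
      using G H that
      by (intro left_wins_sumD[OF H_opts, where i = j and j = i])
        (auto simp: o_R_plus_integer_eq_Left_iff)
    then show ?thesis by (simp add: add.commute)
  qed
  moreover have "o_L (G + H + integer (i + j + 1 + 1)) = Left" if "i + j + 1 < 0"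
    using o_L_plus_integer_succ[OF G] H that
    by (intro left_wins_sumD[OF negative, where i = "i + 1" and j = j]) auto
  ultimately show ?thesis
    by (auto simp: o_R_plus_integer_eq_Left_iff plus_game_sel(2))
qed

section \<open>Monoids of games\<close>

locale integer_invertible_monoid =
  fixes A :: "game set"
  assumes monoid: "game_monoid A"
    and invertible: "integer_invertible A"
begin

lemma plus_closed: "G \<in> A \<Longrightarrow> H \<in> A \<Longrightarrow> G + H \<in> A"
  using monoid by (simp add: game_monoid_def)

lemma integer_in: "integer k \<in> A"
  using invertible by (simp add: integer_invertible_def integer_def)

lemma outcome_plus_integer_uminus:
  assumes "G \<in> A"
  shows "outcome (G + (integer k + integer (- k))) = outcome G"
proof -
  have "outcome (G + (integer (int n) + integer (- int n))) = outcome G" for n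
    using invertible assms
    by (auto simp: integer_invertible_def game_equiv_def game_ge_def integer_of_nat
        integer_uminus_of_nat add.commute intro: antisym)
  from this[of "nat \<bar>k\<bar>"] show ?thesis
    by (cases "k \<ge> 0") (simp_all add: add.commute)
qed

lemma outcome_plus_integer_plus_integer:
  assumes "G \<in> A"
  shows "outcome (G + (integer k + integer l)) = outcome (G + integer (k + l))"
proof -
  have opposite: "outcome (G + (integer k + integer l)) = outcome (G + integer (k + l))"
    if "0 \<le> k + l \<and> k \<le> 0 \<or> k + l \<le> 0 \<and> 0 \<le> k" for k l
  proof -
    have "integer l = integer (k + l) + integer (- k)"
      using integer_add_same_sign[of "k + l" "- k"] that by auto
    then have "G + (integer k + integer l) = G + integer (k + l) + (integer k + integer (- k))"
      by (simp add: ac_simps)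
    then show ?thesis
      using outcome_plus_integer_uminus assms by (simp add: plus_closed integer_in)
  qed
  consider (same_sign) "0 \<le> k \<and> 0 \<le> l \<or> k \<le> 0 \<and> l \<le> 0"
    | (absorb_k) "0 \<le> k + l \<and> k \<le> 0 \<or> k + l \<le> 0 \<and> 0 \<le> k"
    | (absorb_l) "0 \<le> l + k \<and> l \<le> 0 \<or> l + k \<le> 0 \<and> 0 \<le> l"
    by linarith
  then show ?thesis
  proof cases
    case same_sign
    then show ?thesis by (simp only: integer_add_same_sign)
  next
    case absorb_k
    then show ?thesis by (rule opposite)
  next
    case absorb_l
    then show ?thesis
      using opposite[of l k] by (simp only: add.commute[of l] add.commute[of "integer l"])
  qed
qed

lemma o_plus_integer_plus_integer:
  assumes "G \<in> A" "H \<in> A"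
  shows "o_L (G + integer i + (H + integer j)) = o_L (G + H + integer (i + j))"
    and "o_R (G + integer i + (H + integer j)) = o_R (G + H + integer (i + j))"
proof -
  have "outcome (G + integer i + (H + integer j)) = outcome (G + H + integer (i + j))"
    using outcome_plus_integer_plus_integer[of "G + H" i j] assms
    by (simp add: plus_closed ac_simps)
  then show "o_L (G + integer i + (H + integer j)) = o_L (G + H + integer (i + j))"
    and "o_R (G + integer i + (H + integer j)) = o_R (G + H + integer (i + j))"
    by (simp_all add: outcome_eq_outcome_iff)
qed

end

locale stable_monoid = integer_invertible_monoid +
  assumes hereditary: "hereditary A"
    and stable: "outcome_stable A"
begin

lemma P_free_partD: "G \<in> P_free_part A \<Longrightarrow> G \<in> A"
  by (simp add: P_free_part_def)

lemma P_free_part_option: "G \<in> P_free_part A \<Longrightarrow> X |\<in>| options G \<Longrightarrow> X \<in> P_free_part A"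
  using hereditary_P_free_part[OF hereditary] unfolding hereditary_def options_def by blast

lemma o_L_plus_eq_Left:
  assumes "G \<in> P_free_part A" "H \<in> P_free_part A" "o_R G = Left" "o_L H = Left"
  shows "o_L (G + H) = Left"
proof -
  have "outcome G = \<L>" "outcome H = \<L> \<or> outcome H = \<N>"
    using P_free_part_outcome[OF assms(1)] assms(3,4) by (auto simp: outcome_eq_iff)
  then show ?thesis
    using stable assms(1,2) unfolding outcome_stable_def outcome_eq_iff by blast
qed

lemma o_R_plus_eq_Right:
  assumes "G \<in> P_free_part A" "H \<in> P_free_part A" "o_L G = Right" "o_R H = Right"
  shows "o_R (G + H) = Right"
proof -
  have "outcome G = \<R>" "outcome H = \<R> \<or> outcome H = \<N>"
    using P_free_part_outcome[OF assms(1)] assms(3,4) by (auto simp: outcome_eq_iff)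
  then show ?thesis
    using stable assms(1,2) unfolding outcome_stable_def outcome_eq_iff by blast
qed

lemma integer_in_P_free_part: "integer k \<in> P_free_part A"
  by (simp add: P_free_part_def integer_in strictly_P_free_integer)

lemma outcome_plus_unit_integer:
  assumes G: "G \<in> P_free_part A" and k: "\<bar>k\<bar> \<le> 1"
  shows "outcome (G + integer k) \<noteq> \<P>"
proof -
  consider (zero) "k = 0" | (one) "k = 1" | (minus_one) "k = - 1" using k by linarith
  then show ?thesis
  proof cases
    case zero
    then show ?thesis using P_free_part_outcome[OF G] by (simp add: outcome_neq_P_iff)
  next
    case one
    have "o_L (G + integer 1) = Left" if "o_R G = Left"
      using o_L_plus_integer_succ[of G 0] that by simp
    moreover have "o_R (G + integer 1) = Right" if "o_R G = Right"
      using o_R_plus_eq_Right[OF integer_in_P_free_part[of 1] G] that outcome_integer[of 1]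
      by (simp add: outcome_eq_iff add.commute)
    ultimately show ?thesis
      using one by (cases "o_R G") (auto simp: outcome_neq_P_iff)
  next
    case minus_one
    have "o_R (G + integer (- 1)) = Right" if "o_L G = Right"
      using o_R_plus_integer_eq_Left_iff[of G "- 1"] that by auto
    moreover have "o_L (G + integer (- 1)) = Left" if "o_L G = Left"
      using o_L_plus_eq_Left[OF integer_in_P_free_part[of "- 1"] G] that outcome_integer[of "- 1"]
      by (simp add: outcome_eq_iff add.commute)
    ultimately show ?thesis
      using minus_one by (cases "o_L G") (auto simp: outcome_neq_P_iff)
  qed
qed

lemma P_free_part_plus_unit_integer:
  assumes G: "G \<in> P_free_part A" and k: "\<bar>k\<bar> \<le> 1"
  shows "G + integer k \<in> P_free_part A"
proof (rule P_free_part_plusI[OF hereditary G integer_in_P_free_part])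
  show "G + integer k \<in> A"
    using G by (intro plus_closed integer_in P_free_partD)
  fix X Y assume X: "X \<in> P_free_part A" and "Y \<in> subpositions (integer k)"
  then obtain l where "Y = integer l" "\<bar>l\<bar> \<le> 1"
    using k by (auto elim: subpositions_integer)
  then show "outcome (X + Y) \<noteq> \<P>"
    using outcome_plus_unit_integer[OF X] by simp
qed

lemma P_free_part_plus_integer:
  assumes G: "G \<in> P_free_part A"
  shows "G + integer k \<in> P_free_part A"
proof (induction k rule: int_induct[of _ 0])
  case base
  then show ?case using G by simp
next
  case (step1 i)
  then show ?case
    using P_free_part_plus_unit_integer[of "G + integer i" 1] integer_add_same_sign[of i 1]
    by (simp add: add.assoc)
next
  case (step2 i)
  then show ?case
    using P_free_part_plus_unit_integer[of "G + integer i" "- 1"] integer_add_same_sign[of i "- 1"]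
    by (simp add: add.assoc)
qed

lemma o_L_plus_eq_Left_by_transfer:
  assumes G: "G \<in> P_free_part A" and H: "H \<in> P_free_part A"
    and "o_L (G + integer k) = Left" "o_R (H + integer (- k)) = Left"
  shows "o_L (G + H) = Left"
proof -
  have "o_L (H + integer (- k) + (G + integer k)) = Left"
    using o_L_plus_eq_Left[OF P_free_part_plus_integer[OF H] P_free_part_plus_integer[OF G]]
      assms(3,4) by blast
  then show ?thesis
    using o_plus_integer_plus_integer(1)[of H G "- k" k] G H
    by (simp add: P_free_partD add.commute[of H G])
qed

lemma o_R_plus_eq_Right_by_transfer:
  assumes G: "G \<in> P_free_part A" and H: "H \<in> P_free_part A"
    and "o_L (G + integer k) = Right" "o_R (H + integer (- k)) = Right"
  shows "o_R (G + H) = Right"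
proof -
  have "o_R (G + integer k + (H + integer (- k))) = Right"
    using o_R_plus_eq_Right[OF P_free_part_plus_integer[OF G] P_free_part_plus_integer[OF H]]
      assms(3,4) by simp
  then show ?thesis
    using o_plus_integer_plus_integer(2)[of G H k "- k"] G H
    by (simp add: P_free_partD)
qed

end

locale property_X_monoid = stable_monoid +
  assumes property_X: "property_X A"
begin

lemma o_L_plus_eq_Left_if_endlike:
  assumes G: "G \<in> P_free_part A" and H: "H \<in> P_free_part A"
    and G_endlike: "left_endlike G" and H_pred: "o_R (H + integer (- 1)) = Left"
  shows "o_L (G + H) = Left"
proof (rule ccontr)
  assume "o_L (G + H) \<noteq> Left"
  then have lost: "o_L (G + H) = Right" by simp
  have pred: "H + integer (- 1) \<in> P_free_part A" and succ: "G + integer 1 \<in> P_free_part A"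
    using G H by (auto intro: P_free_part_plus_integer)
  have G_first: "o_L G = Left"
    using G_endlike by (simp add: o_L_eq_Left_iff)
  have "o_L H = Left"
    using o_L_plus_integer_succ[OF H_pred] by simp
  moreover have "o_R H = Right"
    using o_L_plus_eq_Left[OF H G] G_first lost by (cases "o_R H") (auto simp: add.commute)
  ultimately have H_N: "outcome H = \<N>" by (simp add: outcome_eq_iff)
  have "o_L (G + integer 1) = Right"
    using o_L_plus_eq_Left_by_transfer[OF G H, of 1] H_pred lost
    by (cases "o_L (G + integer 1)") auto
  then have succ_R: "outcome (G + integer 1) = \<R>"
    using P_free_part_outcome[OF succ] by (simp add: outcome_eq_iff)
  then have "o_R G = Right"
    using o_L_plus_integer_succ[of G 0] by (cases "o_R G") (auto simp: outcome_eq_iff)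
  then have G_N: "outcome G = \<N>"
    using G_first by (simp add: outcome_eq_iff)
  have "outcome (H + integer (- 1)) = \<L>"
    using P_free_part_outcome[OF pred] H_pred by (simp add: outcome_eq_iff)
  then have "rtp G = 1" "ltp H = 1"
    using rtp_eq_1[OF G_N succ_R] ltp_eq_1[OF H_N] by simp_all
  moreover have "\<not> left_endlike H"
    using lost G_endlike o_L_eq_Left_iff[of "G + H"] by (auto simp: left_endlike_plus)
  ultimately have "outcome (G + H) = \<N>"
    using property_X G H G_N H_N G_endlike unfolding property_X_def by blast
  then show False
    using lost by (simp add: outcome_eq_iff)
qed

definition left_wins_smaller_sums :: "game \<Rightarrow> game \<Rightarrow> bool" where
  "left_wins_smaller_sums G H \<longleftrightarrow>
     (\<forall>K\<in>P_free_part A. \<forall>L\<in>P_free_part A.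
        size K + size L < size G + size H \<longrightarrow> left_wins_sum K L)"

lemma left_wins_smaller_sums_commute:
  "left_wins_smaller_sums G H \<longleftrightarrow> left_wins_smaller_sums H G"
  by (simp add: left_wins_smaller_sums_def add.commute)

lemma left_wins_smaller_sumsD:
  assumes "left_wins_smaller_sums G H" "K \<in> P_free_part A" "L \<in> P_free_part A"
    and "size K + size L < size G + size H"
  shows "left_wins_sum K L"
  using assms by (simp add: left_wins_smaller_sums_def)

lemma o_L_plus_plus_integer_if_endlike:
  assumes G: "G \<in> P_free_part A" and H: "H \<in> P_free_part A"
    and endlike: "left_endlike (G + integer i)" and H_second: "o_R (H + integer j) = Left"
  shows "o_L (G + H + integer (i + j + 1)) = Left"
proof -
  have "o_R (H + integer (j + 1) + integer (- 1)) = Left"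
    using o_plus_integer_plus_integer(2)[of H 0 "j + 1" "- 1"] H H_second integer_in[of 0]
    by (simp add: P_free_partD)
  then have "o_L (G + integer i + (H + integer (j + 1))) = Left"
    using G H endlike by (intro o_L_plus_eq_Left_if_endlike P_free_part_plus_integer)
  then show ?thesis
    using o_plus_integer_plus_integer(1)[of G H i "j + 1"] G H
    by (simp add: P_free_partD add.assoc)
qed

lemma o_R_plus_plus_integer_if_smaller_sums:
  assumes K: "K \<in> P_free_part A" and L: "L \<in> P_free_part A"
    and smaller: "left_wins_smaller_sums G H" and size: "size K + size L \<le> size G + size H"
    and K_second: "o_R (K + integer i) = Left" and L_second: "o_R (L + integer j) = Left"
    and negative: "i + j + 1 < 0 \<Longrightarrow> left_wins_sum K L"
  shows "o_R (K + L + integer (i + j + 1)) = Left"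
  using K_second L_second _ _ negative
proof (rule o_R_plus_plus_integer_eq_Left)
  fix X assume "X |\<in>| right_opts K"
  then have "X \<in> P_free_part A" "size X < size K"
    using K by (auto simp: options_def intro: P_free_part_option size_option)
  then show "left_wins_sum X L"
    using L size by (intro left_wins_smaller_sumsD[OF smaller]) auto
next
  fix Y assume "Y |\<in>| right_opts L"
  then have "Y \<in> P_free_part A" "size Y < size L"
    using L by (auto simp: options_def intro: P_free_part_option size_option)
  then show "left_wins_sum Y K"
    using K size by (intro left_wins_smaller_sumsD[OF smaller]) auto
qed

lemma o_L_plus_plus_integer_if_option:
  assumes G: "G \<in> P_free_part A" and H: "H \<in> P_free_part A"
    and smaller: "left_wins_smaller_sums G H"
    and K: "K |\<in>| left_opts G" and K_second: "o_R (K + integer i) = Left"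
    and H_second: "o_R (H + integer j) = Left"
  shows "o_L (G + H + integer (i + j + 1)) = Left"
proof -
  have K_P_free: "K \<in> P_free_part A" and K_size: "size K < size G"
    using K G by (auto simp: options_def intro: P_free_part_option size_option)
  then have "left_wins_sum K H"
    using H by (intro left_wins_smaller_sumsD[OF smaller]) auto
  then have "o_R (K + H + integer (i + j + 1)) = Left"
    using K_size
    by (intro o_R_plus_plus_integer_if_smaller_sums[OF K_P_free H smaller _ K_second H_second]) auto
  then show ?thesis
    using K by (auto simp: o_L_plus_integer_eq_Left_iff plus_game_sel(1))
qed

lemma o_L_plus_plus_integer_if_integer_move:
  assumes G: "G \<in> P_free_part A" and H: "H \<in> P_free_part A"
    and smaller: "left_wins_smaller_sums G H"
    and G_second: "o_R (G + integer (i - 1)) = Left" and H_second: "o_R (H + integer j) = Left"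
    and positive: "i + j + 1 > 0"
  shows "o_L (G + H + integer (i + j + 1)) = Left"
proof -
  have "o_R (G + H + integer (i - 1 + j + 1)) = Left"
    using positive
    by (intro o_R_plus_plus_integer_if_smaller_sums[OF G H smaller _ G_second H_second]) auto
  then show ?thesis
    using positive by (simp add: o_L_plus_integer_eq_Left_iff)
qed

lemma o_L_plus_plus_integer_eq_Left:
  assumes G: "G \<in> P_free_part A" and H: "H \<in> P_free_part A"
    and smaller: "left_wins_smaller_sums G H"
    and G_first: "o_L (G + integer i) = Left" and H_second: "o_R (H + integer j) = Left"
  shows "o_L (G + H + integer (i + j + 1)) = Left"
proof -
  consider (endlike) "left_endlike (G + integer i)"
    | (option) K where "K |\<in>| left_opts G" "o_R (K + integer i) = Left"
    | (integer_move) "i > 0" "o_R (G + integer (i - 1)) = Left"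
    using G_first unfolding o_L_plus_integer_eq_Left_iff by blast
  then show ?thesis
  proof cases
    case endlike
    then show ?thesis using G H H_second by (intro o_L_plus_plus_integer_if_endlike)
  next
    case option
    then show ?thesis using G H smaller H_second by (intro o_L_plus_plus_integer_if_option)
  next
    case integer_move
    \<comment> \<open>If \<open>i + j + 1 \<le> 0\<close>, Left cannot make this move in the sum. But then \<open>j + 1 \<le> 0\<close>, and
      exchanging the summands leads back to the first two cases.\<close>
    have H_first: "o_L (H + integer (j + 1)) = Left"
      using H_second by (rule o_L_plus_integer_succ)
    consider (positive) "i + j + 1 > 0"
      | (endlike) "left_endlike (H + integer (j + 1))"
      | (option) K where "K |\<in>| left_opts H" "o_R (K + integer (j + 1)) = Left"
      using H_first integer_move(1) unfolding o_L_plus_integer_eq_Left_iff by force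
    then show ?thesis
    proof cases
      case positive
      then show ?thesis
        using G H smaller integer_move(2) H_second by (intro o_L_plus_plus_integer_if_integer_move)
    next
      case endlike
      then show ?thesis
        using o_L_plus_plus_integer_if_endlike[OF H G endlike integer_move(2)]
        by (simp add: ac_simps)
    next
      case option
      have "left_wins_smaller_sums H G"
        using smaller by (simp only: left_wins_smaller_sums_commute)
      then show ?thesis
        using o_L_plus_plus_integer_if_option[OF H G _ option integer_move(2)]
        by (simp add: ac_simps)
    qed
  qed
qed

lemma left_wins_sum_P_free_part:
  assumes "G \<in> P_free_part A" "H \<in> P_free_part A"
  shows "left_wins_sum G H"
  using assms
proof (induction "size G + size H" arbitrary: G H rule: less_induct)
  case less
  then have "left_wins_smaller_sums G H"
    by (simp add: left_wins_smaller_sums_def)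
  then show ?case
    using less.prems o_L_plus_plus_integer_eq_Left by (simp add: left_wins_sum_def)
qed

lemma outcome_plus_neq_P:
  assumes G: "G \<in> P_free_part A" and H: "H \<in> P_free_part A"
  shows "outcome (G + H) \<noteq> \<P>"
proof -
  obtain i where first: "o_L (G + integer i) = Left" and tipped: "o_L (G + integer (i + 1)) = Right"
    by (rule left_tipping_integer)
  show ?thesis
  proof (cases "o_R (H + integer (- i - 1))")
    case Left
    then have "o_L (G + H) = Left"
      using left_wins_sumD[OF left_wins_sum_P_free_part[OF G H] first, of "- i - 1" 0] by simp
    then show ?thesis by (simp add: outcome_eq_iff)
  next
    case Right
    then have "o_R (G + H) = Right"
      using o_R_plus_eq_Right_by_transfer[OF G H tipped] by simp
    then show ?thesis by (simp add: outcome_eq_iff)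
  qed
qed

lemma P_free_part_plus_closed:
  assumes "G \<in> P_free_part A" "H \<in> P_free_part A"
  shows "G + H \<in> P_free_part A"
  using assms hereditary
  by (intro P_free_part_plusI plus_closed outcome_plus_neq_P P_free_partD)

end

theorem theorem3p19:
  fixes A :: "game set"
  assumes "game_monoid A"
    and "outcome_stable A"
    and "hereditary A"
    and "integer_invertible A"
    and "property_X A"
  shows "game_monoid (P_free_part A)"
proof -
  interpret property_X_monoid A
    using assms by unfold_locales
  have zero: "0 \<in> P_free_part A"
    using integer_in_P_free_part[of 0] by simp
  show ?thesis
    unfolding game_monoid_def
  proof (intro conjI ballI)
    show "P_free_part A \<noteq> {}" using zero by blast
    show "G + H \<in> P_free_part A" if "G \<in> P_free_part A" "H \<in> P_free_part A" for G H
      using that by (rule P_free_part_plus_closed)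
    show "\<exists>E\<in>P_free_part A. \<forall>G\<in>P_free_part A. game_equiv (P_free_part A) (G + E) G"
      using zero by (intro bexI[of _ 0]) (auto simp: game_equiv_def game_ge_def)
  qed
qed

end
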